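(* Let $(q_n)_{n\ge 0}$ be the associated Pell sequence. The integer solutions $(n,m,d,k)$ of the Diophantine equation $$q_n-q_m=d\left(\frac{10^k-1}{9}\right)$$ with $n>m\ge 0$, $k\ge 1$ and $1\le d\le 9$ are exactly $$(n,m,d,k)\in\{(2,0,2,1),\ (2,1,2,1),\ (3,2,4,1),\ (3,0,6,1),\ (3,1,6,1),\ (7,4,2,3)\}.$$
   Context: The associated Pell sequence $(q_n)_{n\ge 0}$ is defined by $q_0=1$, $q_1=1$ and $q_{n+1}=2q_n+q_{n-1}$ for $n\ge 1$. *)

theory Defs
  imports Complex_Main
begin

fun assoc_pell :: "nat \<Rightarrow> int" where
  "assoc_pell 0 = 1"
| "assoc_pell (Suc 0) = 1"
| "assoc_pell (Suc (Suc n)) = 2 * assoc_pell (Suc n) + assoc_pell n"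

end

theory Submission
  imports Defs
begin

text \<open>
  Write the equation as \<open>9 (q\<^sub>n - q\<^sub>m) = d (10\<^sup>k - 1)\<close>. For \<open>k \<ge> 6\<close> it has no solution for a purely
  local reason: \<open>q\<close> is periodic modulo every integer, and so is \<open>10\<^sup>k\<close> modulo primes other than
  2 and 5, while \<open>10\<^sup>k\<close> vanishes modulo 64 and 5. All periods modulo 64, 5, 7, 11, 17 and 97 divide 96,
  so these moduli restrict \<open>n\<close>, \<open>m\<close>, \<open>k\<close> modulo 96. Refining the residues along the chain
  1, 4, 12, 24, 48, 96, and discarding at each stage the classes excluded by the moduli whose
  periods have become available, keeps the search small and finally leaves no class.
  For \<open>k \<le> 5\<close> the growth of \<open>q\<close> gives \<open>n \<le> 14\<close>, a finite check.
\<close>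

section \<open>Periodicity of the sequence and of the powers of ten\<close>

fun pell_orbit :: "int \<Rightarrow> nat \<Rightarrow> int \<Rightarrow> int \<Rightarrow> int list" where
  "pell_orbit p 0 x y = []"
| "pell_orbit p (Suc a) x y = x # pell_orbit p a y ((2 * y + x) mod p)"

fun ten_powers :: "int \<Rightarrow> nat \<Rightarrow> int \<Rightarrow> int list" where
  "ten_powers p 0 x = []"
| "ten_powers p (Suc b) x = x # ten_powers p b (10 * x mod p)"

lemma length_pell_orbit [simp]: "length (pell_orbit p a x y) = a"
  by (induction a arbitrary: x y) auto

lemma length_ten_powers [simp]: "length (ten_powers p b x) = b"
  by (induction b arbitrary: x) auto

lemma nth_pell_orbit:
  "i < a \<Longrightarrow> pell_orbit p a (assoc_pell j mod p) (assoc_pell (Suc j) mod p) ! i = assoc_pell (j + i) mod p"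
proof (induction a arbitrary: i j)
  case (Suc a)
  show ?case
  proof (cases i)
    case (Suc i')
    have "(2 * (assoc_pell (Suc j) mod p) + assoc_pell j mod p) mod p = assoc_pell (Suc (Suc j)) mod p"
      by (metis assoc_pell.simps(3) mod_add_left_eq mod_add_right_eq mod_mult_right_eq)
    with Suc.IH[of i' "Suc j"] Suc.prems Suc show ?thesis by simp
  qed simp
qed simp

lemma nth_ten_powers: "i < b \<Longrightarrow> ten_powers p b (10 ^ j mod p) ! i = 10 ^ (j + i) mod p"
proof (induction b arbitrary: i j)
  case (Suc b)
  show ?case
  proof (cases i)
    case (Suc i')
    have "10 * (10 ^ j mod p) mod p = 10 ^ Suc j mod p"
      by (simp add: mod_simps)
    with Suc.IH[of i' "Suc j"] Suc.prems Suc show ?thesis by simp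
  qed simp
qed simp

text \<open>A second-order recurrence is determined by two consecutive values, so meeting the
  initial pair again at index \<open>a\<close> repeats the whole sequence modulo
  \<open>p\<close>.\<close>

lemma assoc_pell_periodic:
  assumes "assoc_pell a mod p = 1 mod p" and "assoc_pell (Suc a) mod p = 1 mod p"
  shows "assoc_pell (n + a) mod p = assoc_pell n mod p"
proof (induction n rule: assoc_pell.induct)
  case (3 n)
  then show ?case
    by (simp) (metis mod_add_cong mod_mult_cong)
qed (use assms in auto)

lemma mod_period:
  assumes "\<And>n. f (n + a) = f (n :: nat)"
  shows "f (n mod a) = f n"
proof -
  have "f (i + j * a) = f i" for i j
  proof (induction j)
    case (Suc j)
    then show ?case using assms[of "i + j * a"] by (simp add: algebra_simps)
  qed simp
  from this[of "n mod a" "n div a"] show ?thesis by simp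
qed

definition pell_table :: "int \<Rightarrow> int list \<Rightarrow> bool" where
  "pell_table p qs \<longleftrightarrow> (\<forall>n. assoc_pell n mod p = qs ! (n mod length qs))"

text \<open>Tied to one exponent \<open>k\<close>, unlike \<open>pell_table\<close>: modulo a
  divisor of a power of ten, the table \<open>[0]\<close> is right only once \<open>k\<close> is
  large enough.\<close>

definition power_table :: "int \<Rightarrow> int list \<Rightarrow> nat \<Rightarrow> bool" where
  "power_table p ts k \<longleftrightarrow> 10 ^ k mod p = ts ! (k mod length ts)"

text \<open>The hypothesis \<open>period\<close> records that the orbit is back at its initial pair
  after \<open>a\<close> steps, which evaluation can check.\<close>

lemma pell_table_pell_orbit:
  assumes "1 < p" "0 < a" and period: "drop a (pell_orbit p (Suc (Suc a)) 1 1) = [1, 1]"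
  shows "pell_table p (pell_orbit p a 1 1)"
proof -
  have *: "pell_orbit p b 1 1 ! i = assoc_pell i mod p" if "i < b" for b i
    using nth_pell_orbit[OF that, of p 0] \<open>1 < p\<close> by simp
  have "assoc_pell a mod p = drop a (pell_orbit p (Suc (Suc a)) 1 1) ! 0"
       "assoc_pell (Suc a) mod p = drop a (pell_orbit p (Suc (Suc a)) 1 1) ! 1"
    using *[of a "Suc (Suc a)"] *[of "Suc a" "Suc (Suc a)"] by (auto simp del: pell_orbit.simps)
  then have "assoc_pell a mod p = 1 mod p" "assoc_pell (Suc a) mod p = 1 mod p"
    unfolding period using \<open>1 < p\<close> by auto
  note per = assoc_pell_periodic[OF this]
  have "assoc_pell n mod p = assoc_pell (n mod a) mod p" for n
    using mod_period[of "\<lambda>n. assoc_pell n mod p", OF per] by simp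
  with * \<open>0 < a\<close> show ?thesis by (simp add: pell_table_def)
qed

lemma power_table_ten_powers:
  assumes "1 < p" "0 < b" and period: "drop b (ten_powers p (Suc b) 1) = [1]"
  shows "power_table p (ten_powers p b 1) k"
proof -
  have *: "ten_powers p c 1 ! i = 10 ^ i mod p" if "i < c" for c i
    using nth_ten_powers[OF that, of p 0] \<open>1 < p\<close> by simp
  have "10 ^ b mod p = drop b (ten_powers p (Suc b) 1) ! 0"
    using *[of b "Suc b"] by (auto simp del: ten_powers.simps)
  then have "10 ^ b mod p = 1 mod p"
    unfolding period using \<open>1 < p\<close> by auto
  then have per: "10 ^ (n + b) mod p = 10 ^ n mod p" for n
    by (metis mod_mult_right_eq mult.right_neutral power_add)
  have "10 ^ k mod p = 10 ^ (k mod b) mod p"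
    using mod_period[of "\<lambda>n. 10 ^ n mod p", OF per] by simp
  with * \<open>0 < b\<close> show ?thesis by (simp add: power_table_def)
qed

lemma power_table_zero:
  assumes "p dvd 10 ^ j" "j \<le> k"
  shows "power_table p [0] k"
  using assms by (simp add: power_table_def) (meson dvd_imp_mod_0 dvd_trans le_imp_power_dvd)

section \<open>Sieving the residue classes of solutions\<close>

text \<open>A residue \<open>(n, m, d, k)\<close> has \<open>d\<close> exact and the other entries reduced. A modulus \<open>(p, qs, ts)\<close>
  carries one period of \<open>q\<close> modulo \<open>p\<close> and one period of the powers of ten modulo \<open>p\<close>.\<close>

type_synonym residue = "nat \<times> nat \<times> int \<times> nat"
type_synonym modulus = "int \<times> int list \<times> int list"

fun valid :: "nat \<Rightarrow> modulus \<Rightarrow> bool" where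
  "valid k (p, qs, ts) \<longleftrightarrow> pell_table p qs \<and> power_table p ts k"

fun periods_dvd :: "nat \<Rightarrow> nat \<Rightarrow> modulus \<Rightarrow> bool" where
  "periods_dvd T S (p, qs, ts) \<longleftrightarrow> length qs dvd T \<and> length ts dvd S"

fun admissible :: "residue \<Rightarrow> modulus \<Rightarrow> bool" where
  "admissible (n, m, d, k) (p, qs, ts) \<longleftrightarrow>
     (9 * (qs ! (n mod length qs) - qs ! (m mod length qs)) - d * (ts ! (k mod length ts) - 1)) mod p = 0"

text \<open>The table lengths divide \<open>T\<close> and \<open>S\<close>, so reducing the indices
  first leaves the looked-up entries unchanged; what remains is the equation modulo
  \<open>p\<close>.\<close>

lemma admissible_residues:
  assumes "valid k M" "periods_dvd T S M"
    and eq: "9 * (assoc_pell n - assoc_pell m) = d * (10 ^ k - 1)"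
  shows "admissible (n mod T, m mod T, d, k mod S) M"
proof -
  obtain p qs ts where M: "M = (p, qs, ts)" by (cases M)
  have "qs ! (i mod T mod length qs) = assoc_pell i mod p" for i
    using assms(1,2) by (simp add: M pell_table_def mod_mod_cancel)
  moreover have "ts ! (k mod S mod length ts) = 10 ^ k mod p"
    using assms(1,2) by (simp add: M power_table_def mod_mod_cancel)
  moreover have "(9 * (assoc_pell n mod p - assoc_pell m mod p) - d * (10 ^ k mod p - 1)) mod p
      = (9 * (assoc_pell n - assoc_pell m) - d * (10 ^ k - 1)) mod p"
    by (metis (no_types, lifting) mod_diff_eq mod_mult_right_eq mod_diff_left_eq)
  ultimately show ?thesis using eq by (simp add: M)
qed

definition lifts :: "nat \<Rightarrow> nat \<Rightarrow> nat \<Rightarrow> nat list" where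
  "lifts T r n = map (\<lambda>i. n + T * i) [0..<r]"

lemma mod_mult_in_lifts: "0 < r \<Longrightarrow> n mod (T * r) \<in> set (lifts T r (n mod T))"
  by (auto simp: lifts_def mod_mult2_eq)

text \<open>Indices and exponent have separate moduli \<open>T\<close> and \<open>S\<close>, because
  the periods of the two sequences enter at different stages. The singleton generator for
  \<open>x\<close> serves as a local binding.\<close>

definition refine :: "nat \<Rightarrow> nat \<Rightarrow> nat \<Rightarrow> nat \<Rightarrow> modulus list \<Rightarrow> residue list \<Rightarrow> residue list" where
  "refine T r S s Ms xs = concat (map (\<lambda>(n, m, d, k).
     [x. n' \<leftarrow> lifts T r n, m' \<leftarrow> lifts T r m, k' \<leftarrow> lifts S s k, x \<leftarrow> [(n', m', d, k')],
       list_all (admissible x) Ms]) xs)"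

lemma in_refine:
  assumes eq: "9 * (assoc_pell n - assoc_pell m) = d * (10 ^ k - 1)"
    and xs: "(n mod T, m mod T, d, k mod S) \<in> set xs"
    and Ms: "list_all (valid k) Ms" "list_all (periods_dvd T' S') Ms"
    and T': "T' = T * r" "0 < r" and S': "S' = S * s" "0 < s"
  shows "(n mod T', m mod T', d, k mod S') \<in> set (refine T r S s Ms xs)"
proof -
  have "list_all (admissible (n mod T', m mod T', d, k mod S')) Ms"
    using eq Ms admissible_residues by (auto simp: list_all_iff)
  then show ?thesis
    using mod_mult_in_lifts[OF \<open>0 < r\<close>, of n T] mod_mult_in_lifts[OF \<open>0 < r\<close>, of m T]
      mod_mult_in_lifts[OF \<open>0 < s\<close>, of k S]
    unfolding refine_def T'(1) S'(1) by (auto intro!: bexI[OF _ xs])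
qed

definition unit_modulus :: "int \<Rightarrow> nat \<Rightarrow> nat \<Rightarrow> modulus" where
  "unit_modulus p a b = (p, pell_orbit p a 1 1, ten_powers p b 1)"

definition zero_modulus :: "int \<Rightarrow> nat \<Rightarrow> modulus" where
  "zero_modulus p a = (p, pell_orbit p a 1 1, [0])"

lemma valid_unit_modulus:
  assumes "1 < p" "0 < a" "0 < b"
    and "drop a (pell_orbit p (Suc (Suc a)) 1 1) = [1, 1]"
    and "drop b (ten_powers p (Suc b) 1) = [1]"
  shows "valid k (unit_modulus p a b)"
  using assms pell_table_pell_orbit power_table_ten_powers by (simp add: unit_modulus_def)

lemma valid_zero_modulus:
  assumes "j \<le> k" "1 < p" "0 < a" "p dvd 10 ^ j"
    and "drop a (pell_orbit p (Suc (Suc a)) 1 1) = [1, 1]"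
  shows "valid k (zero_modulus p a)"
  using assms pell_table_pell_orbit power_table_zero by (simp add: zero_modulus_def)

lemma periods_dvd_unit_modulus [simp]: "periods_dvd T S (unit_modulus p a b) \<longleftrightarrow> a dvd T \<and> b dvd S"
  by (simp add: unit_modulus_def)

lemma periods_dvd_zero_modulus [simp]: "periods_dvd T S (zero_modulus p a) \<longleftrightarrow> a dvd T"
  by (simp add: zero_modulus_def)

lemma valid_unit_moduli:
  "valid k (unit_modulus 7 6 6)" "valid k (unit_modulus 11 24 2)"
  "valid k (unit_modulus 17 16 16)" "valid k (unit_modulus 97 96 96)"
  by (rule valid_unit_modulus; code_simp)+

text \<open>The threshold 6 comes from 64 = 2^6: all five moduli divide 10^6.\<close>

lemma valid_zero_moduli:
  assumes "6 \<le> k"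
  shows "valid k (zero_modulus 8 4)" "valid k (zero_modulus 5 12)" "valid k (zero_modulus 16 8)"
    "valid k (zero_modulus 32 16)" "valid k (zero_modulus 64 32)"
  by (rule valid_zero_modulus[OF assms]; code_simp)+

text \<open>Modulo 8 the powers of ten vanish, so this stage ties \<open>n\<close> and
  \<open>m\<close> to \<open>d\<close> while \<open>k\<close> is still known only modulo 1.\<close>

definition residues4 :: "residue list" where
  "residues4 = refine 1 4 1 1 [zero_modulus 8 4] (map (\<lambda>d. (0, 0, d, 0)) [1..9])"

definition residues12 :: "residue list" where
  "residues12 = refine 4 3 1 6 [zero_modulus 5 12, unit_modulus 7 6 6] residues4"

definition residues24 :: "residue list" where
  "residues24 = refine 12 2 6 1 [zero_modulus 16 8, unit_modulus 11 24 2] residues12"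

text \<open>The exponent passes from modulo 6 to modulo 48 = lcm(6, 16), since 10 has order 16
  modulo 17.\<close>

definition residues48 :: "residue list" where
  "residues48 = refine 24 2 6 8 [zero_modulus 32 16, unit_modulus 17 16 16] residues24"

definition residues96 :: "residue list" where
  "residues96 = refine 48 2 48 2 [zero_modulus 64 32, unit_modulus 97 96 96] residues48"

lemma residues96_empty: "residues96 = []"
  by code_simp

lemma exponent_less_6:
  assumes eq: "9 * (assoc_pell n - assoc_pell m) = d * (10 ^ k - 1)" and d: "1 \<le> d" "d \<le> 9"
  shows "k < 6"
proof (rule ccontr)
  assume "\<not> k < 6"
  then have "6 \<le> k" by simp
  note valid = valid_unit_moduli valid_zero_moduli[OF this]
  \<comment> \<open>Modulo 1 there is a single class, so the starting list covers every
    solution.\<close>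
  have "(n mod 1, m mod 1, d, k mod 1) \<in> set (map (\<lambda>d. (0, 0, d, 0)) [1..9])"
    using d by simp
  then have "(n mod 4, m mod 4, d, k mod 1) \<in> set residues4"
    unfolding residues4_def by (rule in_refine[OF eq]) (simp_all add: valid)
  then have "(n mod 12, m mod 12, d, k mod 6) \<in> set residues12"
    unfolding residues12_def by (rule in_refine[OF eq]) (simp_all add: valid)
  then have "(n mod 24, m mod 24, d, k mod 6) \<in> set residues24"
    unfolding residues24_def by (rule in_refine[OF eq]) (simp_all add: valid)
  then have "(n mod 48, m mod 48, d, k mod 48) \<in> set residues48"
    unfolding residues48_def by (rule in_refine[OF eq]) (simp_all add: valid)
  then have "(n mod 96, m mod 96, d, k mod 96) \<in> set residues96"
    unfolding residues96_def by (rule in_refine[OF eq]) (simp_all add: valid)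
  then show False by (simp add: residues96_empty)
qed

section \<open>Growth bound and finite check\<close>

lemma assoc_pell_ge_1: "1 \<le> assoc_pell n"
  by (induction n rule: assoc_pell.induct) auto

lemma assoc_pell_Suc_ge: "assoc_pell n \<le> assoc_pell (Suc n)"
  using assoc_pell_ge_1 by (cases n) (auto simp: add_increasing2 order.trans[OF zero_le_one])

lemma assoc_pell_mono: "m \<le> n \<Longrightarrow> assoc_pell m \<le> assoc_pell n"
  using lift_Suc_mono_le[of assoc_pell] assoc_pell_Suc_ge by blast

text \<open>The worst case is \<open>m = Suc n\<close>, where the recurrence leaves
  \<open>assoc_pell (Suc n) + assoc_pell n\<close>.\<close>

lemma assoc_pell_diff_ge:
  assumes "m < Suc (Suc n)"
  shows "assoc_pell (Suc n) \<le> assoc_pell (Suc (Suc n)) - assoc_pell m"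
  using assoc_pell_mono[of m "Suc n"] assoc_pell_ge_1[of n] assms by simp

lemma index_less_15:
  assumes eq: "9 * (assoc_pell n - assoc_pell m) = d * (10 ^ k - 1)"
    and "d \<le> 9" "k < 6" "m < n"
  shows "n < 15"
proof (rule ccontr)
  assume "\<not> n < 15"
  then obtain n' where n': "n = Suc (Suc n')" "13 \<le> n'"
    by (intro that[of "n - 2"]) auto
  \<comment> \<open>Index 14 is the first at which the sequence exceeds 99999 = 10^5 - 1, the
    largest repdigit with at most five digits.\<close>
  have "assoc_pell 14 = 114243" by code_simp
  with assoc_pell_mono[of 14 "Suc n'"] n' have "114243 \<le> assoc_pell n - assoc_pell m"
    using assoc_pell_diff_ge[of m n'] \<open>m < n\<close> by simp
  moreover have "d * (10 ^ k - 1) \<le> 9 * (10 ^ 5 - 1)"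
    using assms by (intro mult_mono diff_right_mono power_increasing) auto
  ultimately show False using eq by simp
qed

definition small_solutions :: "(nat \<times> nat \<times> int \<times> nat) list" where
  "small_solutions = [(n, m, d, k). n \<leftarrow> [0..<15], m \<leftarrow> [0..<n], k \<leftarrow> [1..<6], d \<leftarrow> [1..9],
     9 * (assoc_pell n - assoc_pell m) = d * (10 ^ k - 1)]"

lemma small_solutions_eq:
  "set small_solutions =
     {(2, 0, 2, 1), (2, 1, 2, 1), (3, 2, 4, 1), (3, 0, 6, 1), (3, 1, 6, 1), (7, 4, 2, 3)}"
  by code_simp

theorem theorem3p1:
  "{(n :: nat, m :: nat, d :: int, k :: nat).
      n > m \<and> m \<ge> 0 \<and> k \<ge> 1 \<and> 1 \<le> d \<and> d \<le> 9 \<and>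
      real_of_int (assoc_pell n) - real_of_int (assoc_pell m)
        = real_of_int d * ((10 ^ k - 1) / 9)}
   = {(2, 0, 2, 1), (2, 1, 2, 1), (3, 2, 4, 1), (3, 0, 6, 1), (3, 1, 6, 1), (7, 4, 2, 3)}"
proof -
  \<comment> \<open>Clearing the denominator moves the equation to the integers, where congruences
    apply.\<close>
  have int_eq: "real_of_int (assoc_pell n) - real_of_int (assoc_pell m) = real_of_int d * ((10 ^ k - 1) / 9)
    \<longleftrightarrow> 9 * (assoc_pell n - assoc_pell m) = d * (10 ^ k - 1)" for n m d k
  proof -
    have "real_of_int (assoc_pell n) - real_of_int (assoc_pell m) = real_of_int d * ((10 ^ k - 1) / 9)
      \<longleftrightarrow> real_of_int (9 * (assoc_pell n - assoc_pell m)) = real_of_int (d * (10 ^ k - 1))"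
      by (simp add: field_simps)
    then show ?thesis by (simp only: of_int_eq_iff)
  qed
  show ?thesis
    unfolding small_solutions_eq[symmetric] int_eq
    using exponent_less_6 index_less_15 by (fastforce simp: small_solutions_def)
qed

end
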